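(* Let $X$ be a finite poset and $K$ a field with $\mathrm{char}(K)\neq 2$. Then a map $\varphi:FI(X,K)\to FI(X,K)$ is a linear unital inverse preserver if and only if $\varphi$ is a unital Jordan endomorphism of $FI(X,K)$. Thus, in this case $\varphi$ is a near sum of an endomorphism and an anti-endomorphism of $FI(X,K)$.
   Context: For a finite poset $(X,\le)$ and a field $K$, the finitary incidence algebra $FI(X,K)$ is the ordinary incidence algebra: the $K$-space of sums $\alpha=\sum_{x\le y}\alpha_{xy}e_{xy}$ ($x,y\in X$, $\alpha_{xy}\in K$, $e_{xy}$ symbols) with product $\alpha\beta=\sum_{x\le y}\big(\sum_{x\le z\le y}\alpha_{xz}\beta_{zy}\big)e_{xy}$ and identity $\delta=\sum_{x\in X}e_{xx}$. It is the direct sum, as a $K$-space, of the commutative subalgebra $D(X,K)=\{\alpha\mid \alpha_{xy}=0\ \forall x<y\}$ and the ideal $J(FI(X,K))=\{\alpha\mid \alpha_{xx}=0\ \forall x\in X\}$. For a unital associative algebra $A$ with group of units $U(A)$, a map $\varphi:A\to A$ is an inverse preserver if $\varphi(U(A))\subseteq U(A)$ and $\varphi(a^{-1})=\varphi(a)^{-1}$ for all $a\in U(A)$; it is unital if $\varphi(1_A)=1_A$. A Jordan endomorphism of a $K$-algebra $A$ is a $K$-linear map $\varphi:A\to A$ with $\varphi(ab+ba)=\varphi(a)\varphi(b)+\varphi(b)\varphi(a)$ for all $a,b\in A$. Linear means $K$-linear. An anti-endomorphism of $A$ is a $K$-linear map $\theta:A\to A$ with $\theta(ab)=\theta(b)\theta(a)$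 for all $a,b\in A$. Near sum (in the sense of Benkovič): if $A=A_0\oplus A_1$ with $A_0$ a subalgebra and $A_1$ an ideal, a linear map $\varphi:A\to A$ is a near sum of an endomorphism $\eta$ and an anti-endomorphism $\theta$ of $A$ (with respect to $A_0$ and $A_1$) if $\varphi|_{A_0}=\eta|_{A_0}=\theta|_{A_0}$, $\varphi|_{A_1}=\eta|_{A_1}+\theta|_{A_1}$, and $\eta(a)\theta(b)=\theta(b)\eta(a)=0$ for all $a,b\in A_1$. Here $A=FI(X,K)$, $A_0=D(X,K)$ and $A_1=J(FI(X,K))$. *)

theory Defs
  imports Complex_Main "HOL-Computational_Algebra.Factorial_Ring"
begin

text \<open>
  A unital associative \<open>K\<close>-algebra is a type of class \<^class>\<open>ring_1\<close> together with an explicit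
  scalar multiplication \<open>s\<close>. The predicate \<open>Vector_Spaces.linear s s\<close> includes the vector
  space axioms for \<open>s\<close>.
\<close>

definition alg_units :: "'a::ring_1 set"
  where "alg_units = {a. \<exists>b. a * b = 1 \<and> b * a = 1}"

definition alg_inv :: "'a::ring_1 \<Rightarrow> 'a"
  where "alg_inv a = (THE b. a * b = 1 \<and> b * a = 1)"

lemma alg_inv_eq:
  fixes a b :: "'a::ring_1"
  assumes "a * b = 1" "b * a = 1"
  shows "alg_inv a = b"
  unfolding alg_inv_def
proof (rule the_equality)
  fix c assume "a * c = 1 \<and> c * a = 1"
  then have "c = c * (a * b)" "c * a = 1" using assms by simp_all
  then show "c = b" by (simp flip: mult.assoc)
qed (use assms in simp)

definition inverse_preserver :: "('a::ring_1 \<Rightarrow> 'a) \<Rightarrow> bool"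
  where "inverse_preserver \<phi> \<longleftrightarrow>
    \<phi> ` alg_units \<subseteq> alg_units \<and> (\<forall>a\<in>alg_units. \<phi> (alg_inv a) = alg_inv (\<phi> a))"

definition unital :: "('a::ring_1 \<Rightarrow> 'a) \<Rightarrow> bool"
  where "unital \<phi> \<longleftrightarrow> \<phi> 1 = 1"

definition jordan_endomorphism :: "('k::field \<Rightarrow> 'a::ring_1 \<Rightarrow> 'a) \<Rightarrow> ('a \<Rightarrow> 'a) \<Rightarrow> bool"
  where "jordan_endomorphism s \<phi> \<longleftrightarrow> Vector_Spaces.linear s s \<phi> \<and>
    (\<forall>a b. \<phi> (a * b + b * a) = \<phi> a * \<phi> b + \<phi> b * \<phi> a)"

text \<open>
  Endomorphisms and anti-endomorphisms are not required to be unital.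
\<close>

definition alg_endomorphism :: "('k::field \<Rightarrow> 'a::ring_1 \<Rightarrow> 'a) \<Rightarrow> ('a \<Rightarrow> 'a) \<Rightarrow> bool"
  where "alg_endomorphism s \<eta> \<longleftrightarrow> Vector_Spaces.linear s s \<eta> \<and>
    (\<forall>a b. \<eta> (a * b) = \<eta> a * \<eta> b)"

definition alg_anti_endomorphism :: "('k::field \<Rightarrow> 'a::ring_1 \<Rightarrow> 'a) \<Rightarrow> ('a \<Rightarrow> 'a) \<Rightarrow> bool"
  where "alg_anti_endomorphism s \<theta> \<longleftrightarrow> Vector_Spaces.linear s s \<theta> \<and>
    (\<forall>a b. \<theta> (a * b) = \<theta> b * \<theta> a)"

definition alg_subalgebra :: "('k::field \<Rightarrow> 'a::ring_1 \<Rightarrow> 'a) \<Rightarrow> 'a set \<Rightarrow> bool"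
  where "alg_subalgebra s B \<longleftrightarrow> module.subspace s B \<and> (\<forall>a\<in>B. \<forall>b\<in>B. a * b \<in> B)"

definition alg_ideal :: "('k::field \<Rightarrow> 'a::ring_1 \<Rightarrow> 'a) \<Rightarrow> 'a set \<Rightarrow> bool"
  where "alg_ideal s I \<longleftrightarrow> module.subspace s I \<and> (\<forall>a. \<forall>b\<in>I. a * b \<in> I \<and> b * a \<in> I)"

definition alg_splitting :: "('k::field \<Rightarrow> 'a::ring_1 \<Rightarrow> 'a) \<Rightarrow> 'a set \<Rightarrow> 'a set \<Rightarrow> bool"
  where "alg_splitting s A\<^sub>0 A\<^sub>1 \<longleftrightarrow> alg_subalgebra s A\<^sub>0 \<and> alg_ideal s A\<^sub>1 \<and>
    (\<forall>a. \<exists>b\<in>A\<^sub>0. \<exists>c\<in>A\<^sub>1. a = b + c) \<and> A\<^sub>0 \<inter> A\<^sub>1 = {0}"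

definition near_sum ::
    "('k::field \<Rightarrow> 'a::ring_1 \<Rightarrow> 'a) \<Rightarrow> 'a set \<Rightarrow> 'a set \<Rightarrow>
      ('a \<Rightarrow> 'a) \<Rightarrow> ('a \<Rightarrow> 'a) \<Rightarrow> ('a \<Rightarrow> 'a) \<Rightarrow> bool"
  where "near_sum s A\<^sub>0 A\<^sub>1 \<phi> \<eta> \<theta> \<longleftrightarrow>
    alg_splitting s A\<^sub>0 A\<^sub>1 \<and> Vector_Spaces.linear s s \<phi> \<and>
    alg_endomorphism s \<eta> \<and> alg_anti_endomorphism s \<theta> \<and>
    (\<forall>a\<in>A\<^sub>0. \<phi> a = \<eta> a \<and> \<phi> a = \<theta> a) \<and>
    (\<forall>a\<in>A\<^sub>1. \<phi> a = \<eta> a + \<theta> a) \<and>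
    (\<forall>a\<in>A\<^sub>1. \<forall>b\<in>A\<^sub>1. \<eta> a * \<theta> b = 0 \<and> \<theta> b * \<eta> a = 0)"

text \<open>
  The formal sum of the \<open>\<alpha>\<^sub>x\<^sub>y e\<^sub>x\<^sub>y\<close> over \<open>x \<le> y\<close> is represented by its coefficient function,
  extended by zero to the pairs with \<open>\<not> x \<le> y\<close>.
\<close>

typedef (overloaded) ('x::"{finite,order}", 'k::field) FI =
  "{f :: 'x \<Rightarrow> 'x \<Rightarrow> 'k. \<forall>x y. \<not> x \<le> y \<longrightarrow> f x y = 0}"
  morphisms fi_coeff Abs_FI
  by (rule exI[of _ "\<lambda>_ _. 0"]) simp

setup_lifting type_definition_FI

lemma fi_eqI: "(\<And>x y. fi_coeff \<alpha> x y = fi_coeff \<beta> x y) \<Longrightarrow> \<alpha> = \<beta>"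
  by transfer (simp add: fun_eq_iff)

lemma fi_coeff_eq_0: "\<not> x \<le> y \<Longrightarrow> fi_coeff \<alpha> x y = 0"
  by transfer simp

lift_definition fi_scale :: "'k \<Rightarrow> ('x::{finite,order}, 'k::field) FI \<Rightarrow> ('x, 'k) FI"
  is "\<lambda>c f x y. c * f x y" by simp

instantiation FI :: ("{finite,order}", field) ring_1
begin

lift_definition zero_FI :: "('a, 'b) FI" is "\<lambda>x y. 0" by simp

lift_definition one_FI :: "('a, 'b) FI" is "\<lambda>x y. if x = y then 1 else 0" by auto

lift_definition plus_FI :: "('a, 'b) FI \<Rightarrow> ('a, 'b) FI \<Rightarrow> ('a, 'b) FI"
  is "\<lambda>f g x y. f x y + g x y" by simp

lift_definition minus_FI :: "('a, 'b) FI \<Rightarrow> ('a, 'b) FI \<Rightarrow> ('a, 'b) FI"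
  is "\<lambda>f g x y. f x y - g x y" by simp

lift_definition uminus_FI :: "('a, 'b) FI \<Rightarrow> ('a, 'b) FI"
  is "\<lambda>f x y. - f x y" by simp

lift_definition times_FI :: "('a, 'b) FI \<Rightarrow> ('a, 'b) FI \<Rightarrow> ('a, 'b) FI"
  is "\<lambda>f g x y. \<Sum>z | x \<le> z \<and> z \<le> y. f x z * g z y"
  by (auto intro!: sum.neutral dest: order_trans)

lemma fi_times_UNIV: "fi_coeff (\<alpha> * \<beta>) x y = (\<Sum>z\<in>UNIV. fi_coeff \<alpha> x z * fi_coeff \<beta> z y)"
  unfolding times_FI.rep_eq
  by (rule sum.mono_neutral_left) (auto, (metis fi_coeff_eq_0)+)

instance
proof
  fix a b c :: "('a, 'b) FI"
  show "a + b + c = a + (b + c)" by transfer (simp add: algebra_simps)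
  show "a + b = b + a" by transfer (simp add: algebra_simps)
  show "0 + a = a" by transfer simp
  show "- a + a = 0" by transfer simp
  show "a - b = a + - b" by transfer simp
  show "a * b * c = a * (b * c)"
  proof (rule fi_eqI)
    fix x y
    have "fi_coeff (a * b * c) x y =
        (\<Sum>z\<in>UNIV. \<Sum>w\<in>UNIV. fi_coeff a x w * fi_coeff b w z * fi_coeff c z y)"
      by (simp add: fi_times_UNIV sum_distrib_right)
    also have "\<dots> = (\<Sum>w\<in>UNIV. \<Sum>z\<in>UNIV. fi_coeff a x w * fi_coeff b w z * fi_coeff c z y)"
      by (rule sum.swap)
    also have "\<dots> = fi_coeff (a * (b * c)) x y"
      by (simp add: fi_times_UNIV sum_distrib_left mult.assoc)
    finally show "fi_coeff (a * b * c) x y = fi_coeff (a * (b * c)) x y" .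
  qed
  show "(a + b) * c = a * c + b * c"
    by (rule fi_eqI) (simp add: fi_times_UNIV plus_FI.rep_eq distrib_right sum.distrib)
  show "a * (b + c) = a * b + a * c"
    by (rule fi_eqI) (simp add: fi_times_UNIV plus_FI.rep_eq distrib_left sum.distrib)
  show "1 * a = a"
    by (rule fi_eqI) (simp add: fi_times_UNIV one_FI.rep_eq if_distrib[of "\<lambda>u. u * _"] cong: if_cong)
  show "a * 1 = a"
    by (rule fi_eqI) (simp add: fi_times_UNIV one_FI.rep_eq if_distrib[of "\<lambda>u. _ * u"] cong: if_cong)
  show "(0 :: ('a, 'b) FI) \<noteq> 1"
    by transfer (metis zero_neq_one)
qed

end

lemma vector_space_FI: "vector_space (fi_scale :: 'k \<Rightarrow> ('x::{finite,order}, 'k::field) FI \<Rightarrow> _)"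
  by unfold_locales (transfer, simp add: algebra_simps)+

lemma fi_scale_mult_left: "fi_scale c \<alpha> * \<beta> = fi_scale c (\<alpha> * \<beta>)"
  by (rule fi_eqI) (simp add: fi_times_UNIV fi_scale.rep_eq sum_distrib_left mult.assoc)

lemma fi_scale_mult_right: "\<alpha> * fi_scale c \<beta> = fi_scale c (\<alpha> * \<beta>)"
  by (rule fi_eqI) (simp add: fi_times_UNIV fi_scale.rep_eq sum_distrib_left mult.left_commute)

definition fi_diagonal :: "('x::{finite,order}, 'k::field) FI set"
  where "fi_diagonal = {\<alpha>. \<forall>x y. x < y \<longrightarrow> fi_coeff \<alpha> x y = 0}"

definition fi_J :: "('x::{finite,order}, 'k::field) FI set"
  where "fi_J = {\<alpha>. \<forall>x. fi_coeff \<alpha> x x = 0}"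

lemma fi_splitting:
  "alg_splitting fi_scale (fi_diagonal :: ('x::{finite,order}, 'k::field) FI set) fi_J"
proof -
  interpret vector_space "fi_scale :: 'k \<Rightarrow> ('x, 'k) FI \<Rightarrow> _" by (rule vector_space_FI)
  have diag: "\<alpha> \<in> fi_diagonal \<longleftrightarrow> (\<forall>x y. x \<noteq> y \<longrightarrow> fi_coeff \<alpha> x y = 0)" for \<alpha> :: "('x, 'k) FI"
    unfolding fi_diagonal_def by (auto simp: less_le intro: fi_coeff_eq_0)
  have coeff_diag: "fi_coeff (\<alpha> * \<beta>) x x = fi_coeff \<alpha> x x * fi_coeff \<beta> x x"
    for \<alpha> \<beta> :: "('x, 'k) FI" and x
  proof -
    have "{z. x \<le> z \<and> z \<le> x} = {x}" by auto
    then show ?thesis by (simp add: times_FI.rep_eq)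
  qed
  have "alg_subalgebra fi_scale (fi_diagonal :: ('x, 'k) FI set)"
    unfolding alg_subalgebra_def subspace_def
    by (auto simp: diag zero_FI.rep_eq plus_FI.rep_eq fi_scale.rep_eq fi_times_UNIV
        intro!: sum.neutral) metis
  moreover have "alg_ideal fi_scale (fi_J :: ('x, 'k) FI set)"
    unfolding alg_ideal_def subspace_def
    by (auto simp: fi_J_def zero_FI.rep_eq plus_FI.rep_eq fi_scale.rep_eq coeff_diag)
  moreover have "\<exists>b\<in>fi_diagonal. \<exists>c\<in>fi_J. \<alpha> = b + c" for \<alpha> :: "('x, 'k) FI"
  proof -
    define b :: "('x, 'k) FI" where "b = Abs_FI (\<lambda>x y. if x = y then fi_coeff \<alpha> x x else 0)"
    have b: "fi_coeff b x y = (if x = y then fi_coeff \<alpha> x x else 0)" for x y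
      unfolding b_def by (subst Abs_FI_inverse) auto
    have "b \<in> fi_diagonal" by (simp add: diag b)
    moreover have "\<alpha> - b \<in> fi_J" by (simp add: fi_J_def minus_FI.rep_eq b)
    ultimately show ?thesis by (intro bexI[of _ b] bexI[of _ "\<alpha> - b"]) simp_all
  qed
  moreover have "fi_diagonal \<inter> fi_J = {0 :: ('x, 'k) FI}"
  proof
    show "fi_diagonal \<inter> fi_J \<subseteq> {0 :: ('x, 'k) FI}"
    proof
      fix \<alpha> :: "('x, 'k) FI" assume "\<alpha> \<in> fi_diagonal \<inter> fi_J"
      then have "fi_coeff \<alpha> x y = fi_coeff 0 x y" for x y
        by (cases "x = y") (auto simp: diag fi_J_def zero_FI.rep_eq)
      then show "\<alpha> \<in> {0}" by (auto intro: fi_eqI)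
    qed
  qed (auto simp: diag fi_J_def zero_FI.rep_eq)
  ultimately show ?thesis unfolding alg_splitting_def by blast
qed

end

theory Submission
  imports Defs
begin

text \<open>
  If \<open>e\<close> is idempotent, then \<open>1 - 2e\<close> is its own inverse, so in characteristic different from \<open>2\<close> a
  linear unital inverse preserver maps idempotents to idempotents. Applied to idempotents such as
  \<open>e\<^sub>x + n\<close> with \<open>n \<in> e\<^sub>x A (1 - e\<^sub>x)\<close>, or \<open>(e\<^sub>x\<^sub>y + e\<^sub>y)(e\<^sub>y + e\<^sub>y\<^sub>w)\<close>, this yields the Jordan identity on
  all pairs of basis elements \<open>e\<^sub>x\<^sub>y\<close>, even when \<open>K\<close> is a small finite field. The converse
  holds in every \<open>2\<close>-torsion-free ring, because a Jordan map satisfies \<open>\<phi>(aba) = \<phi>(a)\<phi>(b)\<phi>(a)\<close>.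
  For the near sum, put \<open>f\<^sub>x = \<phi>(e\<^sub>x)\<close>: these are orthogonal idempotents,
  \<open>\<phi>(e\<^sub>x\<^sub>y) = f\<^sub>x \<phi>(e\<^sub>x\<^sub>y) f\<^sub>y + f\<^sub>y \<phi>(e\<^sub>x\<^sub>y) f\<^sub>x\<close> for \<open>x < y\<close>, and the two summands define \<open>\<eta>\<close> and \<open>\<theta>\<close>.
\<close>

section \<open>Additive maps of rings without 2-torsion\<close>

text \<open>Absence of 2-torsion stands in for characteristic different from 2, so that the ring
  arguments run without scalars.\<close>

locale additive_2tf = additive \<phi> for \<phi> :: "'a::ring_1 \<Rightarrow> 'a" +
  assumes two_torsion_free: "a + a = 0 \<Longrightarrow> a = (0::'a)"
begin

lemma double_cancel: "a + a = b + b \<Longrightarrow> a = (b::'a)"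
  using two_torsion_free[of "a - b"] by (simp add: algebra_simps)

end

section \<open>Jordan maps: sandwich products and inverses\<close>

locale jordan_map = additive_2tf +
  assumes jordan: "\<phi> (a * b + b * a) = \<phi> a * \<phi> b + \<phi> b * \<phi> a"
begin

lemma map_square: "\<phi> (a * a) = \<phi> a * \<phi> a"
  by (rule double_cancel) (use jordan[of a a] in \<open>simp add: add\<close>)

text \<open>Twice \<open>a * b * a\<close> is a combination of Jordan products of \<open>a\<close>,
  \<open>b\<close>, \<open>a * b + b * a\<close> and \<open>a * a\<close>, all of which
  \<open>\<phi>\<close> respects.\<close>

lemma map_sandwich: "\<phi> (a * b * a) = \<phi> a * \<phi> b * \<phi> a"
proof (rule double_cancel)
  have "a * b * a + a * b * a = a * (a * b + b * a) + (a * b + b * a) * a - (a * a * b + b * (a * a))"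
    by (simp add: algebra_simps)
  then have "\<phi> (a * b * a) + \<phi> (a * b * a)
      = \<phi> (a * (a * b + b * a) + (a * b + b * a) * a) - \<phi> (a * a * b + b * (a * a))"
    by (metis add diff)
  also have "\<dots> = \<phi> a * (\<phi> a * \<phi> b + \<phi> b * \<phi> a) + (\<phi> a * \<phi> b + \<phi> b * \<phi> a) * \<phi> a
      - (\<phi> a * \<phi> a * \<phi> b + \<phi> b * (\<phi> a * \<phi> a))"
    by (simp only: jordan map_square)
  also have "\<dots> = \<phi> a * \<phi> b * \<phi> a + \<phi> a * \<phi> b * \<phi> a"
    by (simp add: algebra_simps)
  finally show "\<phi> (a * b * a) + \<phi> (a * b * a) = \<phi> a * \<phi> b * \<phi> a + \<phi> a * \<phi> b * \<phi> a" .
qed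

text \<open>Apply \<open>\<phi>\<close> to \<open>a * b * a = a\<close> and to
  \<open>a * (b * b) * a = 1\<close>. The second image provides a right inverse of
  \<open>\<phi> a\<close>, which cancels the last factor in the first.\<close>

lemma map_inverse:
  assumes "\<phi> 1 = 1" "a * b = 1" "b * a = 1"
  shows "\<phi> a * \<phi> b = 1"
proof -
  have "a * (b * b) * a = (a * b) * (b * a)" by (simp add: mult.assoc)
  then have one: "\<phi> a * (\<phi> b * \<phi> b) * \<phi> a = 1"
    using assms map_sandwich[of a "b * b"] by (simp add: map_square)
  have "\<phi> a * \<phi> b * \<phi> a = \<phi> a"
    using assms map_sandwich[of a b] by simp
  then have "\<phi> a * \<phi> b * (\<phi> a * (\<phi> b * \<phi> b) * \<phi> a) = \<phi> a * (\<phi> b * \<phi> b) * \<phi> a"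
    by (metis mult.assoc)
  then show ?thesis using one by simp
qed

lemma inverse_preserver:
  assumes "\<phi> 1 = 1"
  shows "inverse_preserver \<phi>"
  unfolding inverse_preserver_def
proof (intro conjI ballI subsetI)
  fix c assume "c \<in> \<phi> ` alg_units"
  then show "c \<in> alg_units"
    using map_inverse[OF assms] by (fastforce simp: alg_units_def)
next
  fix a :: 'a assume "a \<in> alg_units"
  then obtain b where b: "a * b = 1" "b * a = 1" by (auto simp: alg_units_def)
  then have "alg_inv a = b" "alg_inv (\<phi> a) = \<phi> b"
    using map_inverse[OF assms] by (blast intro: alg_inv_eq)+
  then show "\<phi> (alg_inv a) = alg_inv (\<phi> a)" by simp
qed

end

section \<open>Jordan identities obtained from preserved idempotents\<close>

locale idempotent_preserver = additive_2tf +
  assumes one: "\<phi> 1 = 1"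
    and idem: "e * e = e \<Longrightarrow> \<phi> e * \<phi> e = \<phi> e"
begin

text \<open>The Jordan identity at a single pair: it is symmetric and biadditive, so it can be
  checked on generators.\<close>

definition jordan_pair :: "'a \<Rightarrow> 'a \<Rightarrow> bool"
  where "jordan_pair a b \<longleftrightarrow> \<phi> (a * b + b * a) = \<phi> a * \<phi> b + \<phi> b * \<phi> a"

lemma jordan_pair_sym: "jordan_pair a b \<Longrightarrow> jordan_pair b a"
  by (simp add: jordan_pair_def add.commute)

lemma jordan_pair_zero: "jordan_pair 0 b"
  by (simp add: jordan_pair_def zero)

lemma jordan_pair_add:
  assumes "jordan_pair a c" "jordan_pair b c"
  shows "jordan_pair (a + b) c"
proof -
  have "(a + b) * c + c * (a + b) = (a * c + c * a) + (b * c + c * b)"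
    by (simp add: algebra_simps)
  then have "\<phi> ((a + b) * c + c * (a + b)) = \<phi> (a * c + c * a) + \<phi> (b * c + c * b)"
    by (simp only: add)
  also have "\<dots> = (\<phi> a * \<phi> c + \<phi> c * \<phi> a) + (\<phi> b * \<phi> c + \<phi> c * \<phi> b)"
    using assms by (simp only: jordan_pair_def)
  finally show ?thesis
    by (simp add: jordan_pair_def add algebra_simps)
qed

lemma jordan_pair_idem: "e * e = e \<Longrightarrow> jordan_pair e e"
  by (simp add: jordan_pair_def add idem)

text \<open>Here \<open>e + f\<close> is idempotent too; the cross terms of the square of its image
  must vanish.\<close>

lemma jordan_pair_orthogonal:
  assumes "e * e = e" "f * f = f" "e * f = 0" "f * e = 0"
  shows "jordan_pair e f"
proof -
  have "\<phi> (e + f) * \<phi> (e + f) = \<phi> (e + f)"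
    using assms by (intro idem) (simp add: algebra_simps)
  then show ?thesis
    using assms by (simp add: jordan_pair_def add zero idem algebra_simps)
qed

text \<open>Both \<open>e + n\<close> and \<open>e - n\<close> are idempotent. Adding the equations
  for their images leaves twice \<open>\<phi> n * \<phi> n\<close>; once this is zero, either
  equation is the Jordan identity.\<close>

lemma
  assumes "e * e = e" "e * n = n" "n * e = 0"
  shows square_corner: "\<phi> n * \<phi> n = 0" and jordan_pair_left: "jordan_pair e n"
proof -
  have nn: "n * n = 0" using assms by (metis mult.assoc mult_zero_left)
  have "\<phi> (e + n) * \<phi> (e + n) = \<phi> (e + n)" "\<phi> (e - n) * \<phi> (e - n) = \<phi> (e - n)"
    using assms nn by (auto intro!: idem simp: algebra_simps)
  then have 1: "\<phi> e * \<phi> n + \<phi> n * \<phi> e + \<phi> n * \<phi> n = \<phi> n"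
    and 2: "- (\<phi> e * \<phi> n + \<phi> n * \<phi> e) + \<phi> n * \<phi> n = - \<phi> n"
    using idem[OF assms(1)] by (simp_all add: add diff algebra_simps)
  show nn: "\<phi> n * \<phi> n = 0"
    by (rule two_torsion_free) (use arg_cong2[of _ _ _ _ "(+)", OF 1 2] in simp)
  show "jordan_pair e n"
    using 1 nn assms by (simp add: jordan_pair_def)
qed

text \<open>The complementary idempotent \<open>1 - e\<close> has \<open>n\<close> in its left
  corner, and \<open>\<phi> 1 = 1\<close> carries the identity back to \<open>e\<close>.\<close>

lemma jordan_pair_right:
  assumes "e * e = e" "e * n = 0" "n * e = n"
  shows "jordan_pair e n"
proof -
  have "jordan_pair (1 - e) n"
    using assms by (intro jordan_pair_left) (simp_all add: algebra_simps)
  then have "\<phi> e * \<phi> n + \<phi> n * \<phi> e = \<phi> n"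
    using assms by (simp add: jordan_pair_def diff one algebra_simps)
  then show ?thesis using assms by (simp add: jordan_pair_def)
qed

text \<open>The corner \<open>e A (1 - e)\<close> is closed under addition and has zero products, so
  \<open>square_corner\<close> can be polarized at \<open>m + n\<close>.\<close>

lemma jordan_pair_corner:
  assumes "e * e = e" "e * m = m" "m * e = 0" "e * n = n" "n * e = 0"
  shows "jordan_pair m n"
proof -
  have "m * n = 0" "n * m = 0" using assms by (metis mult.assoc mult_zero_left)+
  moreover have "\<phi> (m + n) * \<phi> (m + n) = 0"
    using assms by (intro square_corner[of e]) (simp_all add: algebra_simps)
  moreover have "\<phi> m * \<phi> m = 0" "\<phi> n * \<phi> n = 0"
    using assms by (blast intro: square_corner)+
  ultimately show ?thesis by (simp add: jordan_pair_def add zero algebra_simps)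
qed

end

lemma (in additive_2tf) idempotent_preserverI:
  assumes "\<phi> 1 = 1" "inverse_preserver \<phi>"
  shows "idempotent_preserver \<phi>"
proof
  fix e :: 'a assume e: "e * e = e"
  define u where "u = 1 - (e + e)"
  have uu: "u * u = 1" using e by (simp add: u_def algebra_simps)
  then have "u \<in> alg_units" "alg_inv u = u"
    by (auto simp: alg_units_def intro: alg_inv_eq)
  then have "\<phi> u \<in> alg_units" "alg_inv (\<phi> u) = \<phi> u"
    using assms(2) by (auto simp: inverse_preserver_def)
  then have "\<phi> u * \<phi> u = 1" by (auto simp: alg_units_def dest: alg_inv_eq)
  \<comment> \<open>Expanding the square of \<open>1 - 2 \<phi>(e)\<close> gives four times the
    claim, hence two cancellations of 2.\<close>
  then have "(\<phi> e * \<phi> e + \<phi> e * \<phi> e) + (\<phi> e * \<phi> e + \<phi> e * \<phi> e) = (\<phi> e + \<phi> e) + (\<phi> e + \<phi> e)"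
    by (simp add: u_def add diff assms(1) algebra_simps)
  then show "\<phi> e * \<phi> e = \<phi> e" by (rule double_cancel[OF double_cancel])
qed (rule assms(1))

section \<open>The standard basis of the incidence algebra\<close>

text \<open>The basis element e_xy, set to zero when not \<open>x \<le> y\<close> so that sums may
  range over all pairs.\<close>

lift_definition fi_unit :: "'x \<Rightarrow> 'x \<Rightarrow> ('x::{finite,order}, 'k::field) FI"
  is "\<lambda>x y u v. if u = x \<and> v = y \<and> x \<le> y then 1 else 0" by auto

lemma fi_unit_mult:
  fixes x :: "'x::{finite,order}"
  assumes "x \<le> y" "z \<le> w"
  shows "fi_unit x y * fi_unit z w = (if y = z then fi_unit x w else (0 :: ('x, 'k::field) FI))"
proof (rule fi_eqI)
  fix u v
  have "fi_coeff (fi_unit x y * fi_unit z w :: ('x, 'k) FI) u v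
      = (\<Sum>t\<in>UNIV. if t = y then if y = z \<and> u = x \<and> v = w then 1 else 0 else 0)"
    unfolding fi_times_UNIV by (rule sum.cong) (use assms in \<open>auto simp: fi_unit.rep_eq\<close>)
  also have "\<dots> = (if y = z \<and> u = x \<and> v = w then 1 else 0)"
    by simp
  also have "\<dots> = fi_coeff (if y = z then fi_unit x w else (0 :: ('x, 'k) FI)) u v"
    using assms by (auto simp: fi_unit.rep_eq zero_FI.rep_eq)
  finally show "fi_coeff (fi_unit x y * fi_unit z w :: ('x, 'k) FI) u v
      = fi_coeff (if y = z then fi_unit x w else (0 :: ('x, 'k) FI)) u v" .
qed

interpretation fi: vector_space "fi_scale :: 'k \<Rightarrow> ('x::{finite,order}, 'k::field) FI \<Rightarrow> _"
  by (rule vector_space_FI)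

lemma fi_linear_iff:
  "Vector_Spaces.linear fi_scale fi_scale \<phi> \<longleftrightarrow>
    (\<forall>a b. \<phi> (a + b) = \<phi> a + \<phi> b) \<and> (\<forall>c a. \<phi> (fi_scale c a) = fi_scale c (\<phi> a))"
  for \<phi> :: "('x::{finite,order}, 'k::field) FI \<Rightarrow> ('x, 'k) FI"
  by (simp add: Vector_Spaces.linear_def vector_space_FI module_hom_def module_hom_axioms_def
      fi.module_axioms)

lemma fi_coeff_sum: "fi_coeff (sum f A) x y = (\<Sum>i\<in>A. fi_coeff (f i) x y)"
  by (induction A rule: infinite_finite_induct) (auto simp: zero_FI.rep_eq plus_FI.rep_eq)

lemma fi_expand: "a = (\<Sum>x\<in>UNIV. \<Sum>y\<in>UNIV. fi_scale (fi_coeff a x y) (fi_unit x y))"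
proof (rule fi_eqI)
  fix u v
  have entry: "fi_coeff (fi_scale (fi_coeff a x y) (fi_unit x y)) u v
      = (if x = u then if y = v then fi_coeff a u v else 0 else 0)" for x y
    by (auto simp: fi_scale.rep_eq fi_unit.rep_eq fi_coeff_eq_0)
  have "(\<Sum>y\<in>UNIV. fi_coeff (fi_scale (fi_coeff a x y) (fi_unit x y)) u v)
      = (if x = u then fi_coeff a u v else 0)" for x
    by (cases "x = u") (simp_all add: entry)
  then show "fi_coeff a u v
      = fi_coeff (\<Sum>x\<in>UNIV. \<Sum>y\<in>UNIV. fi_scale (fi_coeff a x y) (fi_unit x y)) u v"
    by (simp add: fi_coeff_sum)
qed

text \<open>The basis case is restricted to the support of \<open>a\<close>; this is how membership
  of \<open>a\<close> in \<open>fi_diagonal\<close> or \<open>fi_J\<close> enters later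
  inductions.\<close>

lemma fi_induct:
  assumes zero: "P 0" and add: "\<And>a b. P a \<Longrightarrow> P b \<Longrightarrow> P (a + b)"
    and scale: "\<And>c a. P a \<Longrightarrow> P (fi_scale c a)"
    and unit: "\<And>x y. x \<le> y \<Longrightarrow> fi_coeff a x y \<noteq> 0 \<Longrightarrow> P (fi_unit x y)"
  shows "P a"
proof -
  have P_sum: "P (sum f A)" if "\<And>i. P (f i)" for f and A :: "'a set"
    by (induction A rule: infinite_finite_induct) (use that zero add in auto)
  have "P (fi_scale (fi_coeff a x y) (fi_unit x y))" for x y
  proof (cases "fi_coeff a x y = 0")
    case False
    moreover from this have "x \<le> y" using fi_coeff_eq_0 by blast
    ultimately show ?thesis by (intro scale unit)
  qed (simp add: zero)
  then show ?thesis
    by (subst fi_expand) (intro P_sum)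
qed

section \<open>Idempotent preservers of the incidence algebra\<close>

locale fi_idempotent_preserver = idempotent_preserver \<phi>
  for \<phi> :: "('x::{finite,order}, 'k::field) FI \<Rightarrow> ('x, 'k) FI" +
  assumes scale: "\<phi> (fi_scale c a) = fi_scale c (\<phi> a)"
begin

lemma jordan_pair_diag:
  assumes "z < w"
  shows "jordan_pair (fi_unit x x) (fi_unit z w)"
proof -
  have *: "jordan_pair (fi_unit z z) (fi_unit z w)"
    using assms by (intro jordan_pair_left) (auto simp: fi_unit_mult less_imp_le)
  consider "x = z" | "x = w" | "x \<noteq> z" "x \<noteq> w" by blast
  then show ?thesis
  proof cases
    case 2
    then show ?thesis
      using assms by (intro jordan_pair_right) (auto simp: fi_unit_mult less_imp_le)
  next
    case 3
    \<comment> \<open>The idempotent e_z + e_x still fixes e_zw on the left and kills it on the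
      right; the identity for e_z is then subtracted.\<close>
    have "jordan_pair (fi_unit z z + fi_unit x x) (fi_unit z w)"
      using 3 assms by (intro jordan_pair_left)
        (auto simp: fi_unit_mult less_imp_le distrib_left distrib_right)
    with * show ?thesis
      by (simp add: jordan_pair_def add distrib_left distrib_right) (simp add: algebra_simps)
  qed (simp add: *)
qed

text \<open>Neither \<open>y\<close> nor \<open>w\<close> lies in \<open>{x, z}\<close>, so the
  idempotent supported on \<open>{x, z}\<close> places both units in one corner. The case
  distinction avoids counting e_x twice.\<close>

lemma jordan_pair_noncomposable:
  assumes "x < y" "z < w" "y \<noteq> z" "x \<noteq> w"
  shows "jordan_pair (fi_unit x y) (fi_unit z w)"
  by (rule jordan_pair_corner[of "if x = z then fi_unit x x else fi_unit x x + fi_unit z z"])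
    (use assms in \<open>auto simp: fi_unit_mult less_imp_le distrib_left distrib_right\<close>)

lemma jordan_pair_composable:
  assumes "x < y" "y < w"
  shows "jordan_pair (fi_unit x y) (fi_unit y w)"
proof -
  define e a b c :: "('x, 'k) FI"
    where "e = fi_unit y y" and "a = fi_unit x y" and "b = fi_unit y w" and "c = fi_unit x w"
  note defs = e_def a_def b_def c_def
  have less: "x < w" "x \<le> y" "y \<le> w" "x \<le> w" "x \<noteq> y" "y \<noteq> w" "x \<noteq> w" using assms by auto
  have sq: "\<phi> (fi_unit u v) * \<phi> (fi_unit u v) = 0" if "u < v" for u v
    using that by (intro square_corner[of "fi_unit u u"]) (auto simp: fi_unit_mult less_imp_le)
  \<comment> \<open>This element is \<open>(a + e) * (e + b)\<close>, and
    \<open>(e + b) * (a + e) = e\<close>, whence idempotency. All other Jordan pairs in its square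
    are known already, so only that of \<open>a\<close> and \<open>b\<close> remains.\<close>
  have "(e + a + b + c) * (e + a + b + c) = e + a + b + c"
    using less by (simp add: defs fi_unit_mult distrib_left distrib_right less_imp_le)
  then have "\<phi> (e + a + b + c) * \<phi> (e + a + b + c) = \<phi> (e + a + b + c)"
    by (rule idem)
  moreover have "\<phi> e * \<phi> e = \<phi> e" by (rule idem) (simp add: defs fi_unit_mult)
  moreover have "\<phi> a * \<phi> a = 0" "\<phi> b * \<phi> b = 0" "\<phi> c * \<phi> c = 0"
    using assms less by (simp_all add: defs sq)
  moreover have "\<phi> e * \<phi> a + \<phi> a * \<phi> e = \<phi> a" "\<phi> e * \<phi> b + \<phi> b * \<phi> e = \<phi> b"
      "\<phi> e * \<phi> c + \<phi> c * \<phi> e = 0"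
    using assms less jordan_pair_diag[of x y y] jordan_pair_diag[of y w y] jordan_pair_diag[of x w y]
    by (auto simp: jordan_pair_def defs fi_unit_mult zero)
  moreover have "\<phi> a * \<phi> c + \<phi> c * \<phi> a = 0" "\<phi> b * \<phi> c + \<phi> c * \<phi> b = 0"
    using assms less jordan_pair_noncomposable[of x y x w] jordan_pair_noncomposable[of y w x w]
    by (auto simp: jordan_pair_def defs fi_unit_mult zero)
  moreover have "(p + q + r + s) * (p + q + r + s)
      = p * p + q * q + r * r + s * s + (p * q + q * p) + (p * r + r * p) + (p * s + s * p)
        + (q * r + r * q) + (q * s + s * q) + (r * s + s * r)" for p q r s :: "('x, 'k) FI"
    by (simp add: algebra_simps)
  ultimately have "\<phi> a * \<phi> b + \<phi> b * \<phi> a = \<phi> c"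
    by (simp add: add)
  then show ?thesis
    using less by (simp add: jordan_pair_def defs fi_unit_mult)
qed

lemma jordan_pair_unit:
  assumes "x \<le> y" "z \<le> w"
  shows "jordan_pair (fi_unit x y) (fi_unit z w)"
proof (cases "x = y \<or> z = w")
  case True
  then consider "x = y" "z = w" | "x = y" "z < w" | "x < y" "z = w"
    using assms by fastforce
  then show ?thesis
  proof cases
    case 1
    then show ?thesis
      by (cases "x = z")
        (auto intro: jordan_pair_idem jordan_pair_orthogonal simp: fi_unit_mult)
  qed (auto intro: jordan_pair_diag jordan_pair_sym)
next
  case False
  then have less: "x < y" "z < w" using assms by auto
  then show ?thesis
    using jordan_pair_noncomposable jordan_pair_composable[of x y w]
      jordan_pair_composable[of z w y, THEN jordan_pair_sym] by blast
qed

lemma jordan_pair_scale: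
  assumes "jordan_pair a b"
  shows "jordan_pair (fi_scale c a) b"
  using assms
  by (simp add: jordan_pair_def scale fi_scale_mult_left fi_scale_mult_right
      flip: fi.scale_right_distrib)

lemma fi_jordan_pair: "jordan_pair a b"
proof (rule fi_induct[where P = "\<lambda>a. jordan_pair a b"])
  fix x y :: 'x assume "x \<le> y"
  \<comment> \<open>The closure rules act on the first argument, so symmetry is used to run the
    induction over \<open>b\<close>.\<close>
  have "jordan_pair b (fi_unit x y)"
    by (rule fi_induct[where P = "\<lambda>b. jordan_pair b _"])
      (auto intro: jordan_pair_zero jordan_pair_add jordan_pair_scale jordan_pair_unit \<open>x \<le> y\<close>)
  then show "jordan_pair (fi_unit x y) b" by (rule jordan_pair_sym)
qed (auto intro: jordan_pair_zero jordan_pair_add jordan_pair_scale)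

end

section \<open>Splitting a Jordan endomorphism\<close>

text \<open>The values \<open>p x y\<close> with \<open>\<not> x \<le> y\<close> are irrelevant, their coefficients being zero.\<close>

definition fi_extend :: "('x \<Rightarrow> 'x \<Rightarrow> ('x, 'k) FI) \<Rightarrow> ('x, 'k) FI \<Rightarrow> ('x::{finite,order}, 'k::field) FI"
  where "fi_extend p a = (\<Sum>x\<in>UNIV. \<Sum>y\<in>UNIV. fi_scale (fi_coeff a x y) (p x y))"

lemma fi_extend_add: "fi_extend p (a + b) = fi_extend p a + fi_extend p b"
  by (simp add: fi_extend_def plus_FI.rep_eq fi.scale_left_distrib sum.distrib)

lemma fi_extend_scale: "fi_extend p (fi_scale c a) = fi_scale c (fi_extend p a)"
  by (simp add: fi_extend_def fi_scale.rep_eq fi.scale_sum_right)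

lemma fi_extend_zero: "fi_extend p 0 = 0"
  by (simp add: fi_extend_def zero_FI.rep_eq)

lemma fi_extend_unit:
  assumes "x \<le> y"
  shows "fi_extend p (fi_unit x y) = p x y"
proof -
  have entry: "fi_scale (fi_coeff (fi_unit x y) u v) (p u v)
      = (if u = x then if v = y then p x y else 0 else 0)" for u v
    using assms by (auto simp: fi_unit.rep_eq)
  have "(\<Sum>v\<in>UNIV. fi_scale (fi_coeff (fi_unit x y) u v) (p u v))
      = (if u = x then p x y else 0)" for u
    by (cases "u = x") (simp_all add: entry)
  then show ?thesis by (simp add: fi_extend_def)
qed

lemmas fi_extend_simps = fi_extend_add fi_extend_scale fi_extend_zero fi_extend_unit

lemma linear_fi_extend: "Vector_Spaces.linear fi_scale fi_scale (fi_extend p)"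
  by (simp add: fi_linear_iff fi_extend_simps)

text \<open>Both sides of multiplicativity are bilinear, so nested inductions reduce it to pairs of
  basis elements.\<close>

lemma fi_extend_endomorphism:
  assumes "\<And>x y z w. x \<le> y \<Longrightarrow> z \<le> w \<Longrightarrow> p x y * p z w = (if y = z then p x w else 0)"
  shows "alg_endomorphism fi_scale (fi_extend p)"
proof -
  have "fi_extend p (a * b) = fi_extend p a * fi_extend p b" for a b
  proof (rule fi_induct[where P = "\<lambda>a. fi_extend p (a * b) = _ a * _"])
    fix x y :: 'a assume "x \<le> y"
    show "fi_extend p (fi_unit x y * b) = fi_extend p (fi_unit x y) * fi_extend p b"
    proof (rule fi_induct[where a = b])
      show "fi_extend p (fi_unit x y * fi_unit z w)
          = fi_extend p (fi_unit x y) * fi_extend p (fi_unit z w)" if "z \<le> w" for z w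
        using \<open>x \<le> y\<close> that by (auto simp: fi_unit_mult fi_extend_simps assms)
    qed (simp_all add: fi_extend_simps fi_scale_mult_right distrib_left)
  qed (simp_all add: fi_extend_simps fi_scale_mult_left distrib_right)
  then show ?thesis
    by (simp add: alg_endomorphism_def linear_fi_extend)
qed

lemma fi_extend_anti_endomorphism:
  assumes "\<And>x y z w. x \<le> y \<Longrightarrow> z \<le> w \<Longrightarrow> p z w * p x y = (if y = z then p x w else 0)"
  shows "alg_anti_endomorphism fi_scale (fi_extend p)"
proof -
  have "fi_extend p (a * b) = fi_extend p b * fi_extend p a" for a b
  proof (rule fi_induct[where P = "\<lambda>a. fi_extend p (a * b) = _ * _ a"])
    fix x y :: 'a assume "x \<le> y"
    show "fi_extend p (fi_unit x y * b) = fi_extend p b * fi_extend p (fi_unit x y)"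
    proof (rule fi_induct[where a = b])
      show "fi_extend p (fi_unit x y * fi_unit z w)
          = fi_extend p (fi_unit z w) * fi_extend p (fi_unit x y)" if "z \<le> w" for z w
        using \<open>x \<le> y\<close> that by (auto simp: fi_unit_mult fi_extend_simps assms)
    qed (simp_all add: fi_extend_simps fi_scale_mult_left fi_scale_mult_right distrib_left distrib_right)
  qed (simp_all add: fi_extend_simps fi_scale_mult_left fi_scale_mult_right distrib_left distrib_right)
  then show ?thesis
    by (simp add: alg_anti_endomorphism_def linear_fi_extend)
qed

section \<open>Peirce components of a Jordan endomorphism and the near sum\<close>

locale fi_jordan_map = jordan_map \<phi>
  for \<phi> :: "('x::{finite,order}, 'k::field) FI \<Rightarrow> ('x, 'k) FI" +
  assumes scale: "\<phi> (fi_scale c a) = fi_scale c (\<phi> a)"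
begin

definition diag :: "'x \<Rightarrow> ('x, 'k) FI"
  where "diag x = \<phi> (fi_unit x x)"

text \<open>The Peirce component of the image of e_xy in f_x A f_y; \<open>lower\<close> is the one
  in f_y A f_x. Both equal f_x when \<open>x = y\<close>, which makes the two extensions agree on
  the diagonal.\<close>

definition upper :: "'x \<Rightarrow> 'x \<Rightarrow> ('x, 'k) FI"
  where "upper x y = diag x * \<phi> (fi_unit x y) * diag y"

definition lower :: "'x \<Rightarrow> 'x \<Rightarrow> ('x, 'k) FI"
  where "lower x y = diag y * \<phi> (fi_unit x y) * diag x"

lemma diag_mult: "diag x * diag y = (if x = y then diag x else 0)"
proof -
  have idem: "diag x * diag x = diag x" for x
    using map_square[of "fi_unit x x"] by (simp add: diag_def fi_unit_mult)
  have "diag x * diag y = 0" if "x \<noteq> y"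
  proof -
    \<comment> \<open>Anticommutation turns this product into \<open>- (diag y * diag x)\<close>, so
      orthogonality follows.\<close>
    have "diag x * diag y * diag x = 0"
      using that map_sandwich[of "fi_unit x x" "fi_unit y y"]
      by (simp add: diag_def fi_unit_mult zero)
    moreover have "diag x * diag y = - (diag y * diag x)"
      using that jordan[of "fi_unit x x" "fi_unit y y"]
      by (simp add: diag_def fi_unit_mult zero add_eq_0_iff2)
    ultimately have "- (diag y * (diag x * diag x)) = 0"
      by (simp add: mult.assoc)
    then have "diag y * diag x = 0" by (simp add: idem)
    with \<open>diag x * diag y = - (diag y * diag x)\<close> show ?thesis by simp
  qed
  then show ?thesis by (simp add: idem)
qed

lemma diag_mult_assoc: "diag x * (diag y * a) = (if x = y then diag x * a else 0)"
  by (simp add: diag_mult flip: mult.assoc)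

lemmas diag_simps = diag_mult diag_mult_assoc

lemma upper_diag: "upper x x = diag x" and lower_diag: "lower x x = diag x"
  by (simp_all add: upper_def lower_def diag_mult flip: diag_def)

text \<open>The Jordan identities with e_x and e_y give two expressions for the image. Multiplying
  the second by \<open>diag x\<close> on either side shows that the summands of the first are the
  Peirce components.\<close>

lemma map_unit:
  assumes "x < y"
  shows "\<phi> (fi_unit x y) = upper x y + lower x y"
proof -
  let ?a = "\<phi> (fi_unit x y)"
  have x: "?a = diag x * ?a + ?a * diag x" and y: "?a = diag y * ?a + ?a * diag y"
    using assms jordan[of "fi_unit x x" "fi_unit x y"] jordan[of "fi_unit y y" "fi_unit x y"]
    by (simp_all add: diag_def fi_unit_mult less_imp_le split: if_splits)
  have "x \<noteq> y" using assms by simp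
  have "diag x * ?a = upper x y"
    using \<open>x \<noteq> y\<close> arg_cong[OF y, of "\<lambda>u. diag x * u"]
    by (simp add: upper_def distrib_left diag_simps mult.assoc)
  moreover have "?a * diag x = lower x y"
    using \<open>x \<noteq> y\<close> arg_cong[OF y, of "\<lambda>u. u * diag x"]
    by (simp add: lower_def distrib_right diag_simps mult.assoc)
  ultimately show ?thesis using x by simp
qed

lemma map_unit_jordan:
  assumes "x \<le> y" "z \<le> w" "x \<noteq> w"
  shows "\<phi> (fi_unit x y) * \<phi> (fi_unit z w) + \<phi> (fi_unit z w) * \<phi> (fi_unit x y)
    = (if y = z then \<phi> (fi_unit x w) else 0)"
  using assms jordan[of "fi_unit x y" "fi_unit z w"] by (auto simp: fi_unit_mult zero)

text \<open>In the strict composable case, cutting the Jordan identity for e_xy and e_yw by f_x on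
  the left and f_w on the right kills every other term. The remaining cases follow from
  orthogonality or absorption of the f_x.\<close>

lemma upper_mult:
  assumes "x \<le> y" "z \<le> w"
  shows "upper x y * upper z w = (if y = z then upper x w else 0)"
proof -
  consider "y \<noteq> z" | "y = z" "x = y \<or> y = w" | "y = z" "x < y" "y < w"
    using assms by fastforce
  then show ?thesis
  proof cases
    case 3
    then have "\<phi> (fi_unit x w)
        = \<phi> (fi_unit x y) * \<phi> (fi_unit y w) + \<phi> (fi_unit y w) * \<phi> (fi_unit x y)"
      using map_unit_jordan[of x y y w] by auto
    also have "\<dots> = (upper x y + lower x y) * (upper y w + lower y w)
        + (upper y w + lower y w) * (upper x y + lower x y)"
      using 3 by (simp add: map_unit)
    finally have "upper x w = diag x * ((upper x y + lower x y) * (upper y w + lower y w)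
        + (upper y w + lower y w) * (upper x y + lower x y)) * diag w"
      by (simp add: upper_def)
    also have "\<dots> = upper x y * upper y w"
      using 3 by (auto simp: upper_def lower_def distrib_left distrib_right mult.assoc diag_simps)
    finally show ?thesis using 3 by simp
  qed (auto simp: upper_diag, auto simp: upper_def mult.assoc diag_simps)
qed

lemma lower_mult:
  assumes "x \<le> y" "z \<le> w"
  shows "lower z w * lower x y = (if y = z then lower x w else 0)"
proof -
  consider "y \<noteq> z" | "y = z" "x = y \<or> y = w" | "y = z" "x < y" "y < w"
    using assms by fastforce
  then show ?thesis
  proof cases
    case 3
    then have "\<phi> (fi_unit x w)
        = \<phi> (fi_unit x y) * \<phi> (fi_unit y w) + \<phi> (fi_unit y w) * \<phi> (fi_unit x y)"
      using map_unit_jordan[of x y y w] by auto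
    also have "\<dots> = (upper x y + lower x y) * (upper y w + lower y w)
        + (upper y w + lower y w) * (upper x y + lower x y)"
      using 3 by (simp add: map_unit)
    \<comment> \<open>The cut is reversed, with f_w on the left and f_x on the right, which selects
      the product in the opposite order.\<close>
    finally have "lower x w = diag w * ((upper x y + lower x y) * (upper y w + lower y w)
        + (upper y w + lower y w) * (upper x y + lower x y)) * diag x"
      by (simp add: lower_def)
    also have "\<dots> = lower y w * lower x y"
      using 3 by (auto simp: upper_def lower_def distrib_left distrib_right mult.assoc diag_simps)
    finally show ?thesis using 3 by simp
  qed (auto simp: lower_diag, auto simp: lower_def mult.assoc diag_simps)
qed

text \<open>Orthogonality settles all cases but a shared inner index. There the Jordan product of
  the two units is zero, and a Peirce cut isolates the wanted product.\<close>

lemma upper_lower: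
  assumes "x < y" "z < w"
  shows "upper x y * lower z w = 0" and "lower z w * upper x y = 0"
proof -
  have neq: "x \<noteq> y" "z \<noteq> w" using assms by auto
  show "upper x y * lower z w = 0"
  proof (cases "y = w")
    case True
    have "0 = diag x * (\<phi> (fi_unit x y) * \<phi> (fi_unit z w) + \<phi> (fi_unit z w) * \<phi> (fi_unit x y)) * diag z"
      using assms True map_unit_jordan[of x y z w] by auto
    also have "\<dots> = diag x * ((upper x y + lower x y) * (upper z w + lower z w)
        + (upper z w + lower z w) * (upper x y + lower x y)) * diag z"
      using assms by (simp add: map_unit)
    \<comment> \<open>For \<open>x = z\<close> the two units coincide and both orders survive the
      cut, so the product appears twice and 2-torsion-freeness is invoked.\<close>
    also have "\<dots> = (if x = z then upper x y * lower z w + upper x y * lower z w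
        else upper x y * lower z w)"
      using neq True
      by (auto simp: upper_def lower_def distrib_left distrib_right mult.assoc diag_simps)
    finally show ?thesis
      using two_torsion_free by (metis (full_types))
  qed (simp add: upper_def lower_def mult.assoc diag_simps)
  show "lower z w * upper x y = 0"
  proof (cases "x = z")
    case True
    have "0 = diag w * (\<phi> (fi_unit x y) * \<phi> (fi_unit z w) + \<phi> (fi_unit z w) * \<phi> (fi_unit x y)) * diag y"
      using assms True map_unit_jordan[of x y z w] by auto
    also have "\<dots> = diag w * ((upper x y + lower x y) * (upper z w + lower z w)
        + (upper z w + lower z w) * (upper x y + lower x y)) * diag y"
      using assms by (simp add: map_unit)
    also have "\<dots> = (if y = w then lower z w * upper x y + lower z w * upper x y
        else lower z w * upper x y)"
      using neq True
      by (auto simp: upper_def lower_def distrib_left distrib_right mult.assoc diag_simps)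
    finally show ?thesis
      using two_torsion_free by (metis (full_types))
  qed (simp add: upper_def lower_def mult.assoc diag_simps)
qed

lemma near_sum: "near_sum fi_scale fi_diagonal fi_J \<phi> (fi_extend upper) (fi_extend lower)"
  unfolding near_sum_def
proof (intro conjI ballI)
  show "alg_splitting fi_scale fi_diagonal (fi_J :: ('x, 'k) FI set)" by (rule fi_splitting)
  show "Vector_Spaces.linear fi_scale fi_scale \<phi>" by (simp add: fi_linear_iff add scale)
  show "alg_endomorphism fi_scale (fi_extend upper)"
    by (rule fi_extend_endomorphism) (rule upper_mult)
  show "alg_anti_endomorphism fi_scale (fi_extend lower)"
    by (rule fi_extend_anti_endomorphism) (rule lower_mult)
next
  fix a :: "('x, 'k) FI" assume "a \<in> fi_diagonal"
  then have eq: "x = y" if "x \<le> y" "fi_coeff a x y \<noteq> 0" for x y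
    using that by (auto simp: fi_diagonal_def less_le)
  show "\<phi> a = fi_extend upper a" 
    by (rule fi_induct[where a = a])
      (auto simp: fi_extend_simps zero add scale upper_diag diag_def dest: eq)
  show "\<phi> a = fi_extend lower a"
    by (rule fi_induct[where a = a])
      (auto simp: fi_extend_simps zero add scale lower_diag diag_def dest: eq)
next
  fix a :: "('x, 'k) FI" assume "a \<in> fi_J"
  then have less: "x < y" if "x \<le> y" "fi_coeff a x y \<noteq> 0" for x y
    using that by (auto simp: fi_J_def less_le)
  show "\<phi> a = fi_extend upper a + fi_extend lower a"
    by (rule fi_induct[where a = a])
      (auto simp: fi_extend_simps zero add scale fi.scale_right_distrib map_unit dest: less)
next
  fix a b :: "('x, 'k) FI" assume "a \<in> fi_J" "b \<in> fi_J"
  \<comment> \<open>One fact covers the supports of both elements, as it serves both nested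
    inductions.\<close>
  then have less: "x < y" if "x \<le> y" "fi_coeff a x y \<noteq> 0 \<or> fi_coeff b x y \<noteq> 0" for x y
    using that by (auto simp: fi_J_def less_le)
  have "fi_extend upper a * fi_extend lower b = 0 \<and> fi_extend lower b * fi_extend upper a = 0"
  proof (rule fi_induct[where a = a])
    fix x y assume "x \<le> y" "fi_coeff a x y \<noteq> 0"
    then have "x < y" using less by blast
    show "fi_extend upper (fi_unit x y) * fi_extend lower b = 0 \<and>
        fi_extend lower b * fi_extend upper (fi_unit x y) = 0"
      by (rule fi_induct[where a = b])
        (use \<open>x < y\<close> less in \<open>auto simp: fi_extend_simps fi_scale_mult_left fi_scale_mult_right
          distrib_left distrib_right upper_lower\<close>)
  qed (auto simp: fi_extend_simps fi_scale_mult_left fi_scale_mult_right distrib_left distrib_right)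
  then show "fi_extend upper a * fi_extend lower b = 0" "fi_extend lower b * fi_extend upper a = 0"
    by auto
qed

end

section \<open>The characteristic hypothesis and the equivalence\<close>

lemma fi_two_torsion_free:
  fixes a :: "('x::{finite,order}, 'k::field) FI"
  assumes "CHAR('k) \<noteq> 2" "a + a = 0"
  shows "a = 0"
proof (rule fi_eqI)
  fix x y
  have "of_nat 2 \<noteq> (0 :: 'k)"
  proof
    assume "of_nat 2 = (0 :: 'k)"
    \<comment> \<open>A divisor of 2 is 1 or 2; a field excludes the former and the hypothesis the
      latter.\<close>
    then have dvd: "CHAR('k) dvd 2" by (simp only: of_nat_eq_0_iff_char_dvd)
    then have "CHAR('k) \<le> 2" "CHAR('k) \<noteq> 0" by (auto dest: dvd_imp_le intro: ccontr)
    then show False using assms(1) CHAR_not_1[where 'a = 'k] by linarith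
  qed
  moreover have "2 * fi_coeff a x y = 0"
    using arg_cong[OF assms(2), of "\<lambda>a. fi_coeff a x y"]
    by (simp add: plus_FI.rep_eq zero_FI.rep_eq)
  ultimately show "fi_coeff a x y = fi_coeff 0 x y"
    by (simp add: zero_FI.rep_eq)
qed

theorem corollary2p26:
  fixes \<phi> :: "('x::{finite,order}, 'k::field) FI \<Rightarrow> ('x, 'k) FI"
  assumes "CHAR('k) \<noteq> 2"
  shows "(Vector_Spaces.linear fi_scale fi_scale \<phi> \<and> unital \<phi> \<and> inverse_preserver \<phi>
            \<longleftrightarrow> unital \<phi> \<and> jordan_endomorphism fi_scale \<phi>)
       \<and> (Vector_Spaces.linear fi_scale fi_scale \<phi> \<and> unital \<phi> \<and> inverse_preserver \<phi>
            \<longrightarrow> (\<exists>\<eta> \<theta>. near_sum fi_scale fi_diagonal fi_J \<phi> \<eta> \<theta>))"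
proof -
  have additive_2tf: "additive_2tf \<phi>" if "Vector_Spaces.linear fi_scale fi_scale \<phi>"
  proof
    show "a = 0" if "a + a = 0" for a :: "('x, 'k) FI"
      using assms that by (rule fi_two_torsion_free)
  qed (use that in \<open>simp add: fi_linear_iff\<close>)
  have jordan: "jordan_endomorphism fi_scale \<phi>"
    if "Vector_Spaces.linear fi_scale fi_scale \<phi>" "unital \<phi>" "inverse_preserver \<phi>"
  proof -
    interpret idempotent_preserver \<phi>
      using that additive_2tf.idempotent_preserverI[OF additive_2tf] by (auto simp: unital_def)
    interpret fi_idempotent_preserver \<phi>
      using that by unfold_locales (simp add: fi_linear_iff)
    show ?thesis
      using that(1) fi_jordan_pair by (simp add: jordan_endomorphism_def jordan_pair_def)
  qed
  have fi_jordan_map: "fi_jordan_map \<phi>" if "jordan_endomorphism fi_scale \<phi>"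
  proof -
    have linear: "Vector_Spaces.linear fi_scale fi_scale \<phi>"
      using that by (simp add: jordan_endomorphism_def)
    then interpret additive_2tf \<phi> by (rule additive_2tf)
    show ?thesis
      using that unfolding jordan_endomorphism_def fi_linear_iff by unfold_locales blast+
  qed
  have "inverse_preserver \<phi>" if "unital \<phi>" "jordan_endomorphism fi_scale \<phi>"
  proof -
    interpret fi_jordan_map \<phi> using that(2) by (rule fi_jordan_map)
    show ?thesis using that(1) by (intro inverse_preserver) (simp add: unital_def)
  qed
  then show ?thesis
    using jordan fi_jordan_map[THEN fi_jordan_map.near_sum]
    by (auto simp: jordan_endomorphism_def)
qed

end
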